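(* For $n\in\mathbb N$ and $m\ge1$, $$\sum_{k\ge0}(-q)^{n-k}\,S^o[m,n,k]=1.$$
   Context: $[j]=[j]_q=1+q+\dots+q^{j-1}$. For an integer $l$, $[l]!_m=\prod[j]$ over all positive integers $j\le l$ with $j\equiv l\pmod m$ (empty product $=1$ when $l\le0$). Let $\zeta_m=e^{2\pi i/m}$, $i^c=\zeta_m^c\mathbf e_i$ for $i\in[n]$ (colors mod $m$), $[n^m]=\{0\}\cup\{i^c:i\in[n],0\le c<m\}$, $zS=\{zs:s\in S\}$. A colored set partition of type $(m,n)$ is a set partition of $[n^m]$ into blocks $S_0,\dots,S_{km}$ with (i) $0\in S_0$ and if some $i^c\in S_0$ then all $i^d\in S_0$; (ii) for each $0\le l<k$, $S_{lm+1},\dots,S_{(l+1)m}$ are distinct and of the form $S,\zeta_mS,\dots,\zeta_m^{m-1}S$. With $\operatorname{minb}S=0$ if $0\in S$ and otherwise the least base occurring in $S$, the standard form labels the blocks so that (ii) holds, $s_i=\operatorname{minb}S_i$ satisfy $0=s_0<s_m<\dots<s_{km}$, and $s_j^{\,r}\in S_j$ for $j\in[km]$ where $r=j\bmod m$. An inversion is a pair $(i^0,S_l)$ with $i^0\in S_j$, $j<l$, $i\ge s_l$ (in standard form). $S[m,n,k]=\sum q^{\operatorname{inv}\sigma}$ over type $(m,n)$ colored set partitions with $km+1$ blocks, and $S^o[m,n,k]=[(k-1)m+2]!_m\,S[m,n,k]$. *)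

theory Defs
  imports Complex_Main "HOL-Library.Disjoint_Sets" "HOL-Library.Groups_Big_Fun"
    "HOL-Number_Theory.Cong"
begin

(* Everything depending on q is a function of an element q of an arbitrary ring; taking q
   to be the generator of a polynomial ring or of its fraction field gives the formal version. *)

definition q_int :: "'a::comm_ring_1 \<Rightarrow> nat \<Rightarrow> 'a" where
  "q_int q j = (\<Sum>i<j. q ^ i)"

(* The argument l is an integer since (k - 1) m + 2 may be negative; the set is then empty. *)
definition q_mfact :: "'a::comm_ring_1 \<Rightarrow> nat \<Rightarrow> int \<Rightarrow> 'a" where
  "q_mfact q m l = (\<Prod>j\<in>{j::nat. 0 < j \<and> int j \<le> l \<and> [int j = l] (mod int m)}. q_int q j)"

(* Vectors in C^n are functions on nat, the coordinates being indexed by 1..n;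
   all other coordinates vanish. *)
type_synonym vec = "nat \<Rightarrow> complex"

definition zeta :: "nat \<Rightarrow> complex" where
  "zeta m = exp (2 * complex_of_real pi * \<i> / of_nat m)"

definition zero_vec :: vec where
  "zero_vec = (\<lambda>_. 0)"

definition scale :: "complex \<Rightarrow> vec \<Rightarrow> vec" where
  "scale z x = (\<lambda>j. z * x j)"

definition basis_vec :: "nat \<Rightarrow> vec" where
  "basis_vec i = (\<lambda>j. if j = i then 1 else 0)"

definition colored :: "nat \<Rightarrow> nat \<Rightarrow> nat \<Rightarrow> vec" where
  "colored m i c = scale (zeta m ^ c) (basis_vec i)"

definition colored_set :: "nat \<Rightarrow> nat \<Rightarrow> vec set" where
  "colored_set m n = insert zero_vec {colored m i c |i c. i \<in> {1..n} \<and> c < m}"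

definition colored_labelling :: "nat \<Rightarrow> nat \<Rightarrow> nat \<Rightarrow> (nat \<Rightarrow> vec set) \<Rightarrow> bool" where
  "colored_labelling m n k S \<longleftrightarrow>
     partition_on (colored_set m n) (S ` {0..k * m}) \<and>
     inj_on S {0..k * m} \<and>
     zero_vec \<in> S 0 \<and>
     (\<forall>i\<in>{1..n}. (\<exists>c<m. colored m i c \<in> S 0) \<longrightarrow> (\<forall>d<m. colored m i d \<in> S 0)) \<and>
     (\<forall>l<k. \<exists>T. \<forall>c<m. S (l * m + 1 + c) = scale (zeta m ^ c) ` T)"

(* The partitions themselves, with k m + 1 blocks, are unlabelled. *)
definition colored_partitions :: "nat \<Rightarrow> nat \<Rightarrow> nat \<Rightarrow> vec set set set" where
  "colored_partitions m n k = {S ` {0..k * m} |S. colored_labelling m n k S}"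

definition minb :: "nat \<Rightarrow> vec set \<Rightarrow> nat" where
  "minb m B = (if zero_vec \<in> B then 0 else (LEAST i. 0 < i \<and> (\<exists>c<m. colored m i c \<in> B)))"

definition standard_form ::
    "nat \<Rightarrow> nat \<Rightarrow> nat \<Rightarrow> vec set set \<Rightarrow> (nat \<Rightarrow> vec set) \<Rightarrow> bool" where
  "standard_form m n k P S \<longleftrightarrow>
     colored_labelling m n k S \<and> P = S ` {0..k * m} \<and>
     minb m (S 0) = 0 \<and>
     (\<forall>l<k. minb m (S (l * m)) < minb m (S ((l + 1) * m))) \<and>
     (\<forall>j\<in>{1..k * m}. colored m (minb m (S j)) (j mod m) \<in> S j)"

definition inversions ::
    "nat \<Rightarrow> nat \<Rightarrow> nat \<Rightarrow> (nat \<Rightarrow> vec set) \<Rightarrow> (vec \<times> vec set) set" where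
  "inversions m n k S =
     {(colored m i 0, S l) |i j l. i \<in> {1..n} \<and> j < l \<and> l \<le> k * m \<and>
        colored m i 0 \<in> S j \<and> minb m (S l) \<le> i}"

(* The standard form of a partition is unique on the indices 0..km, and only these
   values enter the set of inversions, so the choice made by SOME is immaterial. *)
definition inv_number :: "nat \<Rightarrow> nat \<Rightarrow> nat \<Rightarrow> vec set set \<Rightarrow> nat" where
  "inv_number m n k P = card (inversions m n k (SOME S. standard_form m n k P S))"

definition q_stirling :: "'a::comm_ring_1 \<Rightarrow> nat \<Rightarrow> nat \<Rightarrow> nat \<Rightarrow> 'a" where
  "q_stirling q m n k = (\<Sum>P\<in>colored_partitions m n k. q ^ inv_number m n k P)"

definition q_stirling_ord :: "'a::comm_ring_1 \<Rightarrow> nat \<Rightarrow> nat \<Rightarrow> nat \<Rightarrow> 'a" where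
  "q_stirling_ord q m n k = q_mfact q m ((int k - 1) * int m + 2) * q_stirling q m n k"

end

theory Submission
  imports Defs
begin

text \<open>In standard form a partition is determined by the word \<open>w\<close> on \<open>{1..n}\<close> whose letter \<open>w i\<close> is the
  index of the block containing \<open>i\<^sup>0\<close>. The words that arise are the restricted growth words: for
  \<open>l < k\<close> the first letter exceeding \<open>l m\<close> is \<open>(l + 1) m\<close>. The inversions become the pairs \<open>(i, l)\<close>
  with \<open>w i < l \<le> max (w 1) \<dots> (w i)\<close>. A last letter \<open>a \<le> k m\<close> that opens no new group thus contributes
  \<open>k m - a\<close> inversions, and one that does contributes none, so
  \<open>S[m, n + 1, k] = S[m, n, k - 1] + [k m + 1] S[m, n, k]\<close>. Substituting this into the alternating sum
  and using \<open>[k m + 2] - q [k m + 1] = 1\<close>, the sum for \<open>n + 1\<close> collapses to the sum for \<open>n\<close>.\<close>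

subsection \<open>Colored vectors\<close>

lemma zeta_power: "zeta m ^ c = cis (2 * pi * real c / real m)"
proof -
  have "zeta m = cis (2 * pi / real m)"
    by (simp add: zeta_def cis_conv_exp mult_ac)
  then show ?thesis
    by (simp add: DeMoivre mult_ac)
qed

lemma zeta_nonzero [simp]: "zeta m \<noteq> 0"
  by (simp add: zeta_def)

lemma zeta_power_self: "m > 0 \<Longrightarrow> zeta m ^ m = 1"
  by (simp add: zeta_power)

lemma zeta_power_mod: "m > 0 \<Longrightarrow> zeta m ^ (c mod m) = zeta m ^ c"
proof -
  assume m: "m > 0"
  have "zeta m ^ c = zeta m ^ (c mod m + m * (c div m))"
    by simp
  also have "\<dots> = zeta m ^ (c mod m)"
    using m by (simp only: power_add power_mult zeta_power_self power_one mult_1_right)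
  finally show ?thesis by simp
qed

lemma zeta_power_inject:
  assumes "c < m" "d < m"
  shows "zeta m ^ c = zeta m ^ d \<longleftrightarrow> c = d"
proof -
  have "inj_on (\<lambda>k. cis (2 * pi * real k / real m)) {..<m}"
    using bij_betw_roots_unity[of m] assms by (simp add: bij_betw_def)
  with assms show ?thesis
    by (auto simp: zeta_power inj_on_def)
qed

lemma colored_neq_zero [simp]: "colored m i c \<noteq> zero_vec" "zero_vec \<noteq> colored m i c"
  by (auto simp: colored_def scale_def basis_vec_def zero_vec_def fun_eq_iff)

lemma colored_inject:
  assumes "c < m" "d < m"
  shows "colored m i c = colored m j d \<longleftrightarrow> i = j \<and> c = d"
proof
  assume eq: "colored m i c = colored m j d"
  have "i = j"
    using fun_cong[OF eq, of i] by (auto simp: colored_def scale_def basis_vec_def split: if_splits)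
  moreover have "zeta m ^ c = zeta m ^ d"
    using fun_cong[OF eq, of i] \<open>i = j\<close> by (auto simp: colored_def scale_def basis_vec_def)
  ultimately show "i = j \<and> c = d"
    using zeta_power_inject[OF assms] by simp
qed simp

lemma scale_scale: "scale x (scale y v) = scale (x * y) v"
  by (simp add: scale_def mult_ac)

lemma scale_colored:
  assumes "m > 0"
  shows "scale (zeta m ^ d) (colored m i c) = colored m i ((c + d) mod m)"
  using assms by (simp add: colored_def scale_scale zeta_power_mod power_add mult_ac)

subsection \<open>Labellings and words\<close>

text \<open>The index of the block containing \<open>i\<^sup>c\<close> when \<open>i\<^sup>0\<close> lies in the block with index \<open>a\<close>.\<close>

definition block_index :: "nat \<Rightarrow> nat \<Rightarrow> nat \<Rightarrow> nat" where
  "block_index m a c = (if a = 0 then 0 else Suc ((a - 1) div m * m + (a - 1 + c) mod m))"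

lemma block_index_zero [simp]: "block_index m 0 c = 0"
  by (simp add: block_index_def)

lemma block_index_Suc:
  assumes "a < m"
  shows "block_index m (Suc (l * m + a)) c = Suc (l * m + (a + c) mod m)"
  using assms by (simp add: block_index_def add.assoc)

lemma block_index_color_zero [simp]: "block_index m a 0 = a"
  by (simp add: block_index_def)

text \<open>Nonzero block indices are always handled in the form \<open>Suc (l * m + a)\<close> with
  group \<open>l\<close> and position \<open>a < m\<close>, so that rotation by a color acts on
  \<open>a\<close> modulo \<open>m\<close> and leaves \<open>l\<close> alone.\<close>

lemma group_index_cases:
  assumes "(m::nat) > 0" "j > 0"
  obtains l a where "a < m" "j = Suc (l * m + a)"
proof
  show "(j - 1) mod m < m" using assms by simp
  show "j = Suc ((j - 1) div m * m + (j - 1) mod m)" using assms by simp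
qed

lemma group_index_less:
  assumes "(a::nat) < m" "Suc (l * m + a) \<le> k * m"
  shows "l < k"
proof (rule ccontr)
  assume "\<not> l < k"
  then have "k * m \<le> l * m" by (intro mult_right_mono) auto
  with assms show False by simp
qed

lemma group_index_le:
  assumes "(a::nat) < m" "l < k"
  shows "Suc (l * m + a) \<le> k * m"
proof -
  have "Suc l * m \<le> k * m" using assms by (intro mult_right_mono) auto
  with assms show ?thesis by simp
qed

lemma group_index_inject:
  assumes "(a::nat) < m" "b < m"
  shows "l * m + a = l' * m + b \<longleftrightarrow> l = l' \<and> a = b"
  using assms by (metis div_mult_self3 div_less add.commute add.right_neutral add_left_cancel not_less_zero)

text \<open>As the color runs modulo \<open>m\<close>, a base whose copy of color 0 lies in group
  \<open>l\<close> visits every block of that group. Hence only the group of the letter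
  \<open>x\<close> matters, not the block \<open>b\<close> that is tested.\<close>

lemma ex_block_index:
  assumes "b < m"
  shows "(\<exists>c<m. block_index m x c = Suc (l * m + b)) \<longleftrightarrow> (\<exists>a<m. x = Suc (l * m + a))"
proof
  assume "\<exists>c<m. block_index m x c = Suc (l * m + b)"
  then obtain c where c: "c < m" "block_index m x c = Suc (l * m + b)" by blast
  then have "x > 0" by (cases x) auto
  then obtain l' a where a: "a < m" "x = Suc (l' * m + a)"
    using assms group_index_cases[of m x] by (metis not_gr0 not_less_zero)
  then have "l' = l"
    using c assms group_index_inject[of "(a + c) mod m" m b l' l] by (simp add: block_index_Suc)
  with a show "\<exists>a<m. x = Suc (l * m + a)" by blast
next
  assume "\<exists>a<m. x = Suc (l * m + a)"
  then obtain a where a: "a < m" "x = Suc (l * m + a)" by blast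
  \<comment> \<open>The color needed is b - a modulo \<open>m\<close>; adding \<open>m\<close> first
    keeps the natural subtraction exact.\<close>
  have "(a + (m - a + b) mod m) mod m = b"
    using a assms by (simp add: mod_simps)
  then show "\<exists>c<m. block_index m x c = Suc (l * m + b)"
    using a assms by (intro exI[of _ "(m - a + b) mod m"]) (simp add: block_index_Suc)
qed

lemma block_index_le:
  assumes "m > 0" "x \<le> k * m"
  shows "block_index m x c \<le> k * m"
proof (cases "x = 0")
  case False
  then obtain l a where a: "a < m" "x = Suc (l * m + a)"
    using assms group_index_cases[of m x] by blast
  with assms show ?thesis
    using group_index_less[of a m l k] by (simp only: block_index_Suc) (intro group_index_le, auto)
qed simp

section \<open>Translating words into labellings and back\<close>

definition word_block :: "nat \<Rightarrow> nat \<Rightarrow> (nat \<Rightarrow> nat) \<Rightarrow> nat \<Rightarrow> vec set" where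
  "word_block m n w j =
     {colored m i c |i c. i \<in> {1..n} \<and> c < m \<and> block_index m (w i) c = j} \<union>
     (if j = 0 then {zero_vec} else {})"

lemma colored_in_word_block:
  assumes "c < m"
  shows "colored m i c \<in> word_block m n w j \<longleftrightarrow> i \<in> {1..n} \<and> block_index m (w i) c = j"
  using assms by (auto simp: word_block_def colored_inject)

lemma zero_in_word_block: "zero_vec \<in> word_block m n w j \<longleftrightarrow> j = 0"
  by (auto simp: word_block_def)

lemma word_block_disjoint:
  assumes "v \<in> word_block m n w j" "v \<in> word_block m n w j'"
  shows "j = j'"
  using assms by (auto simp: word_block_def colored_inject split: if_splits)

lemma minb_word_block_zero [simp]: "minb m (word_block m n w 0) = 0"
  by (simp add: minb_def zero_in_word_block)

text \<open>The right-hand side does not depend on \<open>b\<close>: by rotation all blocks of a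
  group contain the same bases, so they share their least base.\<close>

lemma minb_word_block:
  assumes "b < m"
  shows "minb m (word_block m n w (Suc (l * m + b))) =
           (LEAST i. i \<in> {1..n} \<and> (\<exists>a<m. w i = Suc (l * m + a)))"
proof -
  have "0 < i \<and> (\<exists>c<m. colored m i c \<in> word_block m n w (Suc (l * m + b))) \<longleftrightarrow>
        i \<in> {1..n} \<and> (\<exists>a<m. w i = Suc (l * m + a))" for i
    using ex_block_index[OF assms, of "w i" l] by (auto simp: colored_in_word_block)
  then show ?thesis
    by (simp add: minb_def zero_in_word_block)
qed

text \<open>The condition on the groups keeps every block nonempty, since one letter in a group
  already puts a vector into each of its \<open>m\<close> blocks. No order among the groups is
  imposed yet.\<close>

definition labelling_words :: "nat \<Rightarrow> nat \<Rightarrow> nat \<Rightarrow> (nat \<Rightarrow> nat) set" where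
  "labelling_words m n k =
     {w \<in> {1..n} \<rightarrow>\<^sub>E {0..k * m}. \<forall>l<k. \<exists>i\<in>{1..n}. \<exists>a<m. w i = Suc (l * m + a)}"

lemma word_block_nonempty:
  assumes "m > 0" "w \<in> labelling_words m n k" "j \<le> k * m"
  shows "word_block m n w j \<noteq> {}"
proof (cases "j = 0")
  case False
  then obtain l b where b: "b < m" "j = Suc (l * m + b)"
    using assms group_index_cases[of m j] by blast
  then have "l < k" using assms group_index_less by blast
  then obtain i where "i \<in> {1..n}" "\<exists>a<m. w i = Suc (l * m + a)"
    using assms by (auto simp: labelling_words_def)
  with ex_block_index[OF b(1)] b obtain c where "c < m" "block_index m (w i) c = j" by blast
  with \<open>i \<in> {1..n}\<close> show ?thesis
    using colored_in_word_block by blast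
qed (auto simp: word_block_def)

lemma word_block_inj_on:
  assumes "m > 0" "w \<in> labelling_words m n k"
  shows "inj_on (word_block m n w) {0..k * m}"
proof (rule inj_onI)
  fix j j' assume j: "j \<in> {0..k * m}" and eq: "word_block m n w j = word_block m n w j'"
  then obtain v where "v \<in> word_block m n w j"
    using word_block_nonempty[OF assms, of j] by auto
  with eq show "j = j'" using word_block_disjoint by blast
qed

lemma colored_labelling_word_block:
  assumes m: "m > 0" and w: "w \<in> labelling_words m n k"
  shows "colored_labelling m n k (word_block m n w)"
  unfolding colored_labelling_def
proof (intro conjI ballI allI impI)
  have le: "w i \<le> k * m" if "i \<in> {1..n}" for i
    using w that by (auto simp: labelling_words_def)
  show "partition_on (colored_set m n) (word_block m n w ` {0..k * m})"
  proof (rule partition_onI)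
    show "\<Union> (word_block m n w ` {0..k * m}) = colored_set m n"
    proof (intro equalityI subsetI)
      fix v assume "v \<in> \<Union> (word_block m n w ` {0..k * m})"
      then show "v \<in> colored_set m n"
        by (auto simp: word_block_def colored_set_def split: if_splits)
    next
      fix v assume "v \<in> colored_set m n"
      then consider "v = zero_vec" | i c where "i \<in> {1..n}" "c < m" "v = colored m i c"
        by (auto simp: colored_set_def)
      then show "v \<in> \<Union> (word_block m n w ` {0..k * m})"
      proof cases
        case 1
        then show ?thesis by (auto simp: zero_in_word_block)
      next
        case 2
        with block_index_le[OF m le] show ?thesis
          by (auto simp: colored_in_word_block intro!: bexI[of _ "block_index m (w i) c"])
      qed
    qed
  next
    fix p q assume "p \<in> word_block m n w ` {0..k * m}" "q \<in> word_block m n w ` {0..k * m}" "p \<noteq> q"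
    then show "disjnt p q"
      using word_block_disjoint unfolding disjnt_def by blast
  next
    show "{} \<notin> word_block m n w ` {0..k * m}"
      using word_block_nonempty[OF m w] by (metis atLeastAtMost_iff imageE)
  qed
  show "inj_on (word_block m n w) {0..k * m}"
    by (rule word_block_inj_on[OF m w])
  show "zero_vec \<in> word_block m n w 0"
    by (simp add: zero_in_word_block)
  fix i assume i: "i \<in> {1..n}"
  {
    fix d assume "\<exists>c<m. colored m i c \<in> word_block m n w 0" and d: "d < m"
    then have "w i = 0"
      by (auto simp: colored_in_word_block) (simp add: block_index_def split: if_splits)
    then show "colored m i d \<in> word_block m n w 0"
      using i d by (simp add: colored_in_word_block)
  }
next
  fix l assume "l < k"
  \<comment> \<open>The set \<open>T\<close> will be the first block of the group; multiplication by
    the \<open>c\<close>-th power of \<open>zeta m\<close> moves it \<open>c\<close> places on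
    inside the group.\<close>
  have rotate: "scale (zeta m ^ c) ` word_block m n w (Suc (l * m)) =
      word_block m n w (Suc (l * m + c))" if c: "c < m" for c
  proof (intro equalityI subsetI)
    fix v assume "v \<in> scale (zeta m ^ c) ` word_block m n w (Suc (l * m))"
    then obtain i d where d: "i \<in> {1..n}" "d < m" "block_index m (w i) d = Suc (l * m)"
        "v = colored m i ((d + c) mod m)"
      by (auto simp: word_block_def scale_colored[OF m])
    with ex_block_index[of 0 m "w i" l] m obtain a where a: "a < m" "w i = Suc (l * m + a)"
      by auto
    with d have "(a + d) mod m = 0"
      by (simp add: block_index_Suc)
    then have "(a + (d + c)) mod m = c"
      using c by (metis add.assoc add_0 mod_add_left_eq mod_less)
    then have "block_index m (w i) ((d + c) mod m) = Suc (l * m + c)"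
      using a by (simp add: block_index_Suc mod_simps)
    with d m show "v \<in> word_block m n w (Suc (l * m + c))"
      by (simp add: colored_in_word_block)
  next
    fix v assume "v \<in> word_block m n w (Suc (l * m + c))"
    then obtain i d where d: "i \<in> {1..n}" "d < m" "block_index m (w i) d = Suc (l * m + c)"
        "v = colored m i d"
      by (auto simp: word_block_def)
    with ex_block_index[of c m "w i" l] c obtain a where a: "a < m" "w i = Suc (l * m + a)"
      by auto
    \<comment> \<open>This is the color d - c modulo \<open>m\<close>, the one that the preimage of
      \<open>v\<close> under the rotation must have.\<close>
    define e where "e = (d + (m - c)) mod m"
    have ad: "(a + d) mod m = c"
      using a d by (simp add: block_index_Suc)
    have "(a + e) mod m = ((a + d) mod m + (m - c)) mod m"
      by (simp add: e_def mod_simps add.assoc)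
    also have "\<dots> = 0"
      using c by (simp add: ad)
    finally have "block_index m (w i) e = Suc (l * m)"
      using a by (simp add: block_index_Suc)
    then have "colored m i e \<in> word_block m n w (Suc (l * m))"
      using d m by (simp add: colored_in_word_block e_def)
    moreover have "scale (zeta m ^ c) (colored m i e) = v"
      using c d by (simp add: scale_colored[OF m] e_def mod_simps)
    ultimately show "v \<in> scale (zeta m ^ c) ` word_block m n w (Suc (l * m))"
      by blast
  qed
  then show "\<exists>T. \<forall>c<m. word_block m n w (l * m + 1 + c) = scale (zeta m ^ c) ` T"
    by (intro exI[of _ "word_block m n w (Suc (l * m))"]) auto
qed

text \<open>The letter of \<open>i\<close> is the index of the block containing \<open>i\<close>
  with color 0. The other colors follow from it: block 0 is closed under change of color, and the
  blocks of a group are the rotations of one set.\<close>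

lemma colored_labelling_word:
  assumes m: "m > 0" and S: "colored_labelling m n k S"
  obtains w where "w \<in> labelling_words m n k" "\<And>j. j \<le> k * m \<Longrightarrow> S j = word_block m n w j"
proof -
  have part: "partition_on (colored_set m n) (S ` {0..k * m})" and inj: "inj_on S {0..k * m}"
    and zero: "zero_vec \<in> S 0"
    and saturated: "\<And>i c d. i \<in> {1..n} \<Longrightarrow> c < m \<Longrightarrow> d < m \<Longrightarrow>
      colored m i c \<in> S 0 \<Longrightarrow> colored m i d \<in> S 0"
    and rotate: "\<And>l. l < k \<Longrightarrow> \<exists>T. \<forall>c<m. S (Suc (l * m + c)) = scale (zeta m ^ c) ` T"
    using S unfolding colored_labelling_def One_nat_def add_0_right add_Suc_right add_Suc by blast+
  have unique: "j = j'" if "v \<in> S j" "v \<in> S j'" "j \<le> k * m" "j' \<le> k * m" for v j j'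
  proof -
    have "S j = S j'"
      using that disjointD[OF partition_onD2[OF part], of "S j" "S j'"] by auto
    with inj that show ?thesis by (auto dest: inj_onD)
  qed
  have "\<exists>j\<le>k * m. colored m i 0 \<in> S j" if "i \<in> {1..n}" for i
  proof -
    have "colored m i 0 \<in> colored_set m n"
      using that m by (auto simp: colored_set_def)
    then show ?thesis
      using partition_onD1[OF part] by auto
  qed
  then obtain f where f: "f i \<le> k * m" "colored m i 0 \<in> S (f i)" if "i \<in> {1..n}" for i
    by metis
  define w where "w = restrict f {1..n}"
  have in_block: "colored m i c \<in> S (block_index m (w i) c)" if i: "i \<in> {1..n}" and c: "c < m" for i c
  proof (cases "w i = 0")
    case True
    with f[OF i] saturated[OF i m c] show ?thesis using i by (simp add: w_def)
  next
    case False
    then obtain l a where a: "a < m" "w i = Suc (l * m + a)"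
      using m group_index_cases[of m "w i"] by blast
    have "l < k"
      using f[OF i] a i group_index_less by (simp add: w_def)
    then obtain T where T: "\<And>c. c < m \<Longrightarrow> S (Suc (l * m + c)) = scale (zeta m ^ c) ` T"
      using rotate by blast
    \<comment> \<open>Pulling color 0 back to \<open>T\<close> and rotating again multiplies
      \<open>v\<close> by the power a + c of the root. The exponent may be reduced modulo
      \<open>m\<close> and so names a block of the same group.\<close>
    obtain v where v: "v \<in> T" "colored m i 0 = scale (zeta m ^ a) v"
      using f(2)[OF i] a T[OF a(1)] i by (auto simp: w_def)
    have "colored m i c = scale (zeta m ^ c) (colored m i 0)"
      using c by (simp add: scale_colored[OF m])
    also have "\<dots> = scale (zeta m ^ ((a + c) mod m)) v"
      by (simp add: v scale_scale zeta_power_mod[OF m] power_add mult_ac)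
    finally show ?thesis
      using v T[of "(a + c) mod m"] m a by (auto simp: block_index_Suc)
  qed
  have w_le: "w i \<le> k * m" if "i \<in> {1..n}" for i
    using f(1) that by (simp add: w_def)
  have eq: "S j = word_block m n w j" if j: "j \<le> k * m" for j
  proof (intro equalityI subsetI)
    fix v assume v: "v \<in> S j"
    then have "v \<in> colored_set m n"
      using partition_onD1[OF part] j by auto
    then consider "v = zero_vec" | i c where "i \<in> {1..n}" "c < m" "v = colored m i c"
      by (auto simp: colored_set_def)
    then show "v \<in> word_block m n w j"
    proof cases
      case 1
      then have "j = 0" using unique[of v j 0] v j zero by simp
      with 1 show ?thesis by (simp add: zero_in_word_block)
    next
      case 2
      then have "j = block_index m (w i) c"
        using unique[OF v _ j] in_block block_index_le[OF m w_le] by blast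
      with 2 show ?thesis by (simp add: colored_in_word_block)
    qed
  next
    fix v assume "v \<in> word_block m n w j"
    then consider "v = zero_vec" "j = 0"
      | i c where "i \<in> {1..n}" "c < m" "v = colored m i c" "block_index m (w i) c = j"
      by (auto simp: word_block_def split: if_splits)
    then show "v \<in> S j"
      using in_block zero by cases auto
  qed
  moreover have "w \<in> labelling_words m n k"
    unfolding labelling_words_def
  proof (intro CollectI conjI allI impI)
    show "w \<in> {1..n} \<rightarrow>\<^sub>E {0..k * m}"
      using f(1) by (auto simp: w_def)
    fix l assume l: "l < k"
    then have le: "Suc (l * m + 0) \<le> k * m"
      using m by (intro group_index_le)
    then have "S (Suc (l * m)) \<noteq> {}"
      using partition_onD3[OF part] by (metis add_0_right atLeastAtMost_iff image_eqI zero_le)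
    then obtain v where "v \<in> word_block m n w (Suc (l * m))"
      using eq[OF le] by auto
    then obtain i c where "i \<in> {1..n}" "c < m" "block_index m (w i) c = Suc (l * m + 0)"
      by (auto simp: word_block_def)
    then show "\<exists>i\<in>{1..n}. \<exists>a<m. w i = Suc (l * m + a)"
      using ex_block_index[OF m, of "w i" l] by blast
  qed
  ultimately show ?thesis using that by blast
qed

subsection \<open>Standard forms and restricted growth words\<close>

text \<open>\<open>Suc l * m\<close> is the last label of group \<open>l\<close>; it is divisible by
  \<open>m\<close>, so in standard form its block holds the least base of the group with color 0.
  The bound on the earlier letters says that the groups are opened in order.\<close>

definition growth_words :: "nat \<Rightarrow> nat \<Rightarrow> nat \<Rightarrow> (nat \<Rightarrow> nat) set" where
  "growth_words m n k =
     {w \<in> {1..n} \<rightarrow>\<^sub>E {0..k * m}.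
        \<forall>l<k. \<exists>i\<in>{1..n}. w i = Suc l * m \<and> (\<forall>i'\<in>{1..<i}. w i' \<le> l * m)}"

lemma Suc_mult_group: "(m::nat) > 0 \<Longrightarrow> Suc l * m = Suc (l * m + (m - 1))"
  by simp

text \<open>If the least base has color 0 in the last block of its group, then advancing the color
  by \<open>j mod m\<close> brings it to block \<open>j\<close>. This is the color condition of the
  standard form.\<close>

lemma block_index_last:
  assumes "b < m"
  shows "block_index m (Suc l * m) (Suc (l * m + b) mod m) = Suc (l * m + b)"
proof -
  have "(m - 1 + Suc (l * m + b) mod m) mod m = (m - 1 + Suc (l * m + b)) mod m"
    by (rule mod_add_right_eq)
  also have "m - 1 + Suc (l * m + b) = b + Suc l * m"
    using assms by simp
  also have "\<dots> mod m = b"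
    using assms by (simp only: mod_mult_self1 mod_less)
  finally have "block_index m (Suc (l * m + (m - 1))) (Suc (l * m + b) mod m) = Suc (l * m + b)"
    using assms by (simp only: block_index_Suc diff_less zero_less_one)
  then show ?thesis
    using assms by (simp add: add.commute)
qed

lemma growth_words_subset:
  assumes "m > 0"
  shows "growth_words m n k \<subseteq> labelling_words m n k"
  unfolding growth_words_def labelling_words_def Suc_mult_group[OF assms]
  using assms by (fastforce intro: exI[of _ "m - 1"])

lemma growth_words_le: "w \<in> growth_words m n k \<Longrightarrow> i \<in> {1..n} \<Longrightarrow> w i \<le> k * m"
  by (auto simp: growth_words_def)

text \<open>The first letter above \<open>l * m\<close> lies in group \<open>l\<close>, so its
  position is the first with a letter in that group and hence the least base of each of its
  blocks.\<close>

lemma growth_word_first: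
  assumes w: "w \<in> growth_words m n k" and l: "l < k"
  obtains s where "s \<in> {1..n}" "w s = Suc l * m" "\<And>i. i \<in> {1..<s} \<Longrightarrow> w i \<le> l * m"
    "\<And>b. b < m \<Longrightarrow> minb m (word_block m n w (Suc (l * m + b))) = s"
proof -
  obtain s where s: "s \<in> {1..n}" "w s = Suc l * m" "\<And>i. i \<in> {1..<s} \<Longrightarrow> w i \<le> l * m"
    using w l unfolding growth_words_def by blast
  have "minb m (word_block m n w (Suc (l * m + b))) = s" if b: "b < m" for b
    unfolding minb_word_block[OF b]
  proof (rule Least_equality)
    have "w s = Suc (l * m + (m - 1))"
      using s(2) b Suc_mult_group[of m l] by simp
    with b s(1) show "s \<in> {1..n} \<and> (\<exists>a<m. w s = Suc (l * m + a))"
      by (intro conjI exI[of _ "m - 1"]) auto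
    fix i assume "i \<in> {1..n} \<and> (\<exists>a<m. w i = Suc (l * m + a))"
    then show "s \<le> i"
      using s(3)[of i] by fastforce
  qed
  with s that show ?thesis by blast
qed

lemma standard_form_word_block:
  assumes m: "m > 0" and w: "w \<in> growth_words m n k"
  shows "standard_form m n k (word_block m n w ` {0..k * m}) (word_block m n w)"
  unfolding standard_form_def
proof (intro conjI allI impI ballI)
  show "colored_labelling m n k (word_block m n w)"
    using colored_labelling_word_block[OF m] growth_words_subset[OF m] w by blast
  show "minb m (word_block m n w 0) = 0" by simp
next
  fix l assume "l < k"
  then obtain s where s: "s \<in> {1..n}" "w s = Suc l * m"
      "minb m (word_block m n w (Suc l * m)) = s"
    using growth_word_first[OF w] m Suc_mult_group[OF m, of l] by (metis diff_less zero_less_one)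
  show "minb m (word_block m n w (l * m)) < minb m (word_block m n w ((l + 1) * m))"
  proof (cases l)
    case 0
    with s show ?thesis by simp
  next
    case (Suc l')
    with \<open>l < k\<close> obtain s' where s': "s' \<in> {1..n}" "w s' = Suc l' * m"
        "\<And>i. i \<in> {1..<s'} \<Longrightarrow> w i \<le> l' * m" "minb m (word_block m n w (Suc l' * m)) = s'"
      using growth_word_first[OF w, of l'] m Suc_mult_group[OF m, of l']
      by (metis Suc_lessD diff_less zero_less_one)
    \<comment> \<open>If \<open>s\<close> came before \<open>s'\<close>, the letter
      \<open>Suc l * m\<close> would violate the bound on the letters before \<open>s'\<close>;
      equality is excluded because the two letters differ.\<close>
    have "s' < s"
    proof (rule ccontr)
      assume "\<not> s' < s"
      then consider "s = s'" | "s \<in> {1..<s'}" using s(1) by fastforce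
      then show False
        using s(2) s'(2) s'(3)[of s] m Suc by cases auto
    qed
    with s s' Suc show ?thesis by simp
  qed
next
  fix j assume j: "j \<in> {1..k * m}"
  with m obtain l b where b: "b < m" "j = Suc (l * m + b)"
    using group_index_cases[of m j] by (metis atLeastAtMost_iff less_le_trans zero_less_one)
  then have "l < k" using j group_index_less by simp
  then obtain s where s: "s \<in> {1..n}" "w s = Suc l * m" "minb m (word_block m n w j) = s"
    using growth_word_first[OF w] b by metis
  have "block_index m (w s) (j mod m) = j"
    using block_index_last[OF b(1)] b s by simp
  with s m show "colored m (minb m (word_block m n w j)) (j mod m) \<in> word_block m n w j"
    by (simp add: colored_in_word_block)
qed simp

text \<open>The color condition at the labels divisible by \<open>m\<close> fixes the letters of the
  least bases, and the increasing order of the least bases bounds the letters before them.\<close>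

lemma standard_form_word:
  assumes m: "m > 0" and S: "standard_form m n k P S"
  obtains w where "w \<in> growth_words m n k" "\<And>j. j \<le> k * m \<Longrightarrow> S j = word_block m n w j"
proof -
  have "colored_labelling m n k S"
    using S by (simp add: standard_form_def)
  then obtain w where w: "w \<in> labelling_words m n k"
    and eq: "\<And>j. j \<le> k * m \<Longrightarrow> S j = word_block m n w j"
    using colored_labelling_word[OF m] by blast
  define f where "f l = minb m (word_block m n w (l * m))" for l
  have "f l < f (Suc l)" if "l < k" for l
    using S that unfolding standard_form_def f_def
    by (metis Suc_eq_plus1 Suc_leI eq less_imp_le_nat mult_le_mono1)
  then have f_step: "f l \<le> f (Suc l)" if "l < k" for l
    using that by (simp add: less_imp_le)
  have f_mono: "f l \<le> f (l + d)" if "l + d \<le> k" for l d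
    using that
  proof (induction d)
    case (Suc d)
    with f_step[of "l + d"] show ?case by simp
  qed simp
  have "w \<in> growth_words m n k"
    unfolding growth_words_def
  proof (intro CollectI conjI allI impI)
    show "w \<in> {1..n} \<rightarrow>\<^sub>E {0..k * m}"
      using w by (simp add: labelling_words_def)
    fix l assume l: "l < k"
    then have le: "Suc l * m \<le> k * m" by (intro mult_right_mono) auto
    have "\<forall>j\<in>{1..k * m}. colored m (minb m (S j)) (j mod m) \<in> S j"
      using S unfolding standard_form_def by blast
    then have "colored m (f (Suc l)) (Suc l * m mod m) \<in> S (Suc l * m)"
      using le m eq[OF le] unfolding f_def by (metis One_nat_def Suc_leI atLeastAtMost_iff nat_0_less_mult_iff zero_less_Suc)
    then have "colored m (f (Suc l)) 0 \<in> word_block m n w (Suc l * m)"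
      using eq[OF le] by simp
    then have first: "f (Suc l) \<in> {1..n}" "w (f (Suc l)) = Suc l * m"
      using m by (simp_all add: colored_in_word_block)
    \<comment> \<open>A letter above \<open>l * m\<close> lies in some group
      \<open>g \<ge> l\<close>, so the least base of group \<open>g\<close> is at most
      \<open>i\<close> and thus below that of group \<open>l\<close>. This contradicts the
      monotonicity of \<open>f\<close>.\<close>
    moreover have "w i \<le> l * m" if i: "i \<in> {1..<f (Suc l)}" for i
    proof (rule ccontr)
      assume "\<not> w i \<le> l * m"
      then have "w i > 0" by simp
      then obtain g a where g: "a < m" "w i = Suc (g * m + a)"
        using m group_index_cases[of m "w i"] by blast
      have "i \<in> {1..n}" using i first by auto
      then have "g < k"
        using g w group_index_less[OF g(1), of g k] PiE_mem[of w "{1..n}" "\<lambda>_. {0..k * m}" i]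
        by (simp add: labelling_words_def)
      have "l \<le> g"
        using \<open>\<not> w i \<le> l * m\<close> g group_index_le[of a m g l] by fastforce
      have "f (Suc g) \<le> i"
        unfolding f_def Suc_mult_group[OF m] using m \<open>i \<in> {1..n}\<close> g
        by (subst minb_word_block) (auto intro!: Least_le)
      moreover have "f (Suc l) \<le> f (Suc g)"
        using f_mono[of "Suc l" "g - l"] \<open>l \<le> g\<close> \<open>g < k\<close> by simp
      ultimately show False using i by simp
    qed
    ultimately show "\<exists>i\<in>{1..n}. w i = Suc l * m \<and> (\<forall>i'\<in>{1..<i}. w i' \<le> l * m)"
      by blast
  qed
  with eq that show ?thesis by blast
qed

section \<open>Uniqueness and existence of the standard form\<close>

lemma strict_mono_same_image:
  fixes f g :: "nat \<Rightarrow> nat"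
  assumes "\<And>l. l < k \<Longrightarrow> f l < f (Suc l)" "\<And>l. l < k \<Longrightarrow> g l < g (Suc l)"
    and "f ` {..k} = g ` {..k}" "l \<le> k"
  shows "f l = g l"
proof -
  \<comment> \<open>Listing the values gives two strictly increasing lists with the same set of
    entries, and such lists coincide.\<close>
  have "sorted_wrt (<) (map h [0..<Suc k])" if "\<And>l. l < k \<Longrightarrow> h l < h (Suc l)" for h :: "nat \<Rightarrow> nat"
    using that by (auto simp: sorted_wrt_iff_nth_Suc_transp nth_append less_Suc_eq simp del: upt_Suc)
  then have "map f [0..<Suc k] = map g [0..<Suc k]"
    using assms by (intro strict_sorted_equal) (auto simp: atLeast0LessThan lessThan_Suc_atMost simp del: upt_Suc)
  then have "\<forall>l\<in>set [0..<Suc k]. f l = g l"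
    by (simp only: map_eq_conv)
  with assms(4) show ?thesis
    by (cases "l = k") auto
qed

text \<open>The least bases of the blocks, taken in increasing order, tell the group of every block.
  Inside a group the position of a block is read off from the color that the least base has in it.
  So the unlabelled partition determines the word.\<close>

lemma word_block_image_inj_on:
  assumes m: "m > 0"
  shows "inj_on (\<lambda>w. word_block m n w ` {0..k * m}) (growth_words m n k)"
proof (rule inj_onI)
  fix w w' assume w: "w \<in> growth_words m n k" and w': "w' \<in> growth_words m n k"
    and eq: "word_block m n w ` {0..k * m} = word_block m n w' ` {0..k * m}"
  define f where "f w l = minb m (word_block m n w (l * m))" for w l
  have f_step: "f u l < f u (Suc l)" if "u \<in> growth_words m n k" "l < k" for u l
    using standard_form_word_block[OF m that(1)] that(2)
    by (simp add: standard_form_def f_def)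
  have f_minb: "minb m (word_block m n u (Suc (l * m + b))) = f u (Suc l)"
    if "b < m" for u l b
    using minb_word_block[OF that, of n u l] minb_word_block[of "m - 1" m n u l] m
    by (simp add: f_def add.commute)
  have f_image: "f u ` {..k} = minb m ` word_block m n u ` {0..k * m}" for u
  proof (intro equalityI subsetI)
    fix x assume "x \<in> f u ` {..k}"
    then show "x \<in> minb m ` word_block m n u ` {0..k * m}"
      by (auto simp: f_def)
  next
    fix x assume "x \<in> minb m ` word_block m n u ` {0..k * m}"
    then obtain j where j: "j \<le> k * m" "x = minb m (word_block m n u j)"
      by auto
    show "x \<in> f u ` {..k}"
    proof (cases "j = 0")
      case True
      with j show ?thesis by (auto simp: f_def intro!: image_eqI[of _ _ 0])
    next
      case False
      then obtain l b where b: "b < m" "j = Suc (l * m + b)"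
        using m group_index_cases[of m j] by blast
      then have "l < k" using j group_index_less by blast
      with b j f_minb show ?thesis by (auto intro!: image_eqI[of _ _ "Suc l"])
    qed
  qed
  have f_eq: "f w l = f w' l" if "l \<le> k" for l
    using strict_mono_same_image[of k "f w" "f w'" l] f_step w w' f_image eq that by simp
  have f_inj: "l = l'" if "f w l = f w l'" "l \<le> k" "l' \<le> k" for l l'
  proof -
    have f_less: "f w a < f w (a + Suc d)" if "a + Suc d \<le> k" for a d
      using that
    proof (induction d)
      case 0
      with f_step[OF w, of a] show ?case by simp
    next
      case (Suc d)
      with f_step[OF w, of "a + Suc d"] show ?case by simp
    qed
    show ?thesis
    proof (cases l l' rule: linorder_cases)
      case less
      with f_less[of l "l' - Suc l"] that show ?thesis by simp
    next
      case greater
      with f_less[of l' "l - Suc l'"] that show ?thesis by simp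
    qed
  qed
  have "w i = w' i" if i: "i \<in> {1..n}" for i
  proof -
    have le: "w i \<le> k * m" "w' i \<le> k * m"
      using growth_words_le w w' i by blast+
    then obtain j where "word_block m n w (w i) = word_block m n w' j"
      using eq by (metis (no_types, lifting) atLeastAtMost_iff imageE image_eqI zero_le)
    moreover have "colored m i 0 \<in> word_block m n w (w i)"
      using i m by (simp add: colored_in_word_block)
    ultimately have block_eq: "word_block m n w (w i) = word_block m n w' (w' i)"
      using m by (simp add: colored_in_word_block)
    show ?thesis
    proof (cases "w i = 0")
      case True
      with block_eq show ?thesis
        by (metis zero_in_word_block)
    next
      case False
      with block_eq have "w' i \<noteq> 0"
        by (metis zero_in_word_block)
      obtain l b where b: "b < m" "w i = Suc (l * m + b)"
        using m False group_index_cases[of m "w i"] by blast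
      obtain l' b' where b': "b' < m" "w' i = Suc (l' * m + b')"
        using m \<open>w' i \<noteq> 0\<close> group_index_cases[of m "w' i"] by blast
      have "l < k" "l' < k"
        using b b' le group_index_less[of b m l k] group_index_less[of b' m l' k] by simp_all
      have "f w (Suc l) = f w' (Suc l')"
        using f_minb[OF b(1), of w l] f_minb[OF b'(1), of w' l'] b b' block_eq by simp
      then have "f w (Suc l) = f w (Suc l')"
        using f_eq[of "Suc l'"] \<open>l' < k\<close> by simp
      then have "l = l'"
        using f_inj[of "Suc l" "Suc l'"] \<open>l < k\<close> \<open>l' < k\<close> by simp
      have first: "\<exists>s\<in>{1..n}. u s = Suc l * m \<and> f u (Suc l) = s" if u: "u \<in> growth_words m n k" for u
        using growth_word_first[OF u \<open>l < k\<close>] f_minb[OF m, of u l] m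
        by (metis (full_types))
      obtain s where s: "s \<in> {1..n}" "w s = Suc l * m" "f w (Suc l) = s"
        using first[OF w] by blast
      obtain s' where s': "w' s' = Suc l * m" "f w' (Suc l) = s'"
        using first[OF w'] by blast
      have "s = s'"
        using s s' f_eq \<open>l < k\<close> by simp
      \<comment> \<open>The least base \<open>s\<close> has color \<open>w i mod m\<close> in the
        block of \<open>i\<close>. Since \<open>s\<close> has the same letter in both words, finding
        it with this color in the same block forces \<open>w' i = w i\<close>.\<close>
      have "block_index m (w s) (w i mod m) = w i"
        using block_index_last[OF b(1)] b s by simp
      then have "colored m s (w i mod m) \<in> word_block m n w (w i)"
        using s m by (simp add: colored_in_word_block)
      then have "colored m s (w i mod m) \<in> word_block m n w' (w' i)"
        by (simp only: block_eq)
      then show ?thesis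
        using \<open>block_index m (w s) (w i mod m) = w i\<close> s s' \<open>s = s'\<close> m
        by (simp add: colored_in_word_block)
    qed
  qed
  with w w' show "w = w'"
    by (intro PiE_ext[of w "{1..n}" "\<lambda>_. {0..k * m}"]) (auto simp: growth_words_def)
qed

text \<open>The groups of blocks are reordered by their least bases, \<open>\<rho>\<close> giving the new position, and the
  blocks of each group are rotated so that the least base with color \<open>0\<close> falls into the last one.\<close>

lemma ex_growth_word:
  assumes m: "m > 0" and v: "v \<in> labelling_words m n k"
  obtains w where "w \<in> growth_words m n k"
    "word_block m n w ` {0..k * m} = word_block m n v ` {0..k * m}"
proof -
  define t where "t l = (LEAST i. i \<in> {1..n} \<and> (\<exists>a<m. v i = Suc (l * m + a)))" for l
  have t: "t l \<in> {1..n} \<and> (\<exists>a<m. v (t l) = Suc (l * m + a))" if "l < k" for l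
  proof -
    have "\<exists>i\<in>{1..n}. \<exists>a<m. v i = Suc (l * m + a)"
      using v that by (auto simp: labelling_words_def)
    then have "\<exists>i. i \<in> {1..n} \<and> (\<exists>a<m. v i = Suc (l * m + a))"
      by blast
    then show ?thesis
      unfolding t_def by (rule LeastI_ex)
  qed
  have t_le: "t l \<le> i" if "i \<in> {1..n}" "a < m" "v i = Suc (l * m + a)" for i l a
    unfolding t_def by (rule Least_le) (use that in blast)
  \<comment> \<open>\<open>\<alpha> l\<close> is the position, within group \<open>l\<close>, of the
    block that contains the least base with color 0.\<close>
  obtain \<alpha> where \<alpha>: "\<alpha> l < m" "v (t l) = Suc (l * m + \<alpha> l)" if "l < k" for l
    using t by metis
  have t_inj: "l = l'" if "t l = t l'" "l < k" "l' < k" for l l'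
    using that \<alpha>[of l] \<alpha>[of l'] group_index_inject[of "\<alpha> l" m "\<alpha> l'" l l'] by simp
  \<comment> \<open>Counting the smaller least bases ranks the groups; as distinct groups have
    distinct least bases, the ranks permute the groups.\<close>
  define \<rho> where "\<rho> l = card {l'. l' < k \<and> t l' < t l}" for l
  have \<rho>_mono: "\<rho> l < \<rho> l'" if "t l < t l'" "l < k" for l l'
    unfolding \<rho>_def using that by (intro psubset_card_mono) auto
  have \<rho>_less: "\<rho> l < k" if "l < k" for l
  proof -
    have "{l'. l' < k \<and> t l' < t l} \<subset> {..<k}"
      using that by auto
    then have "\<rho> l < card {..<k}"
      unfolding \<rho>_def by (intro psubset_card_mono) simp
    then show ?thesis by simp
  qed
  have \<rho>_inj: "inj_on \<rho> {..<k}"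
  proof (rule inj_onI)
    fix l l' assume "l \<in> {..<k}" "l' \<in> {..<k}" "\<rho> l = \<rho> l'"
    then show "l = l'"
      using \<rho>_mono[of l l'] \<rho>_mono[of l' l] t_inj[of l l'] by (cases "t l" "t l'" rule: linorder_cases) auto
  qed
  then have \<rho>_surj: "\<rho> ` {..<k} = {..<k}"
    using \<rho>_less by (intro endo_inj_surj) auto
  \<comment> \<open>The shift by \<open>m - 1 - \<alpha> l\<close> carries position
    \<open>\<alpha> l\<close> to \<open>m - 1\<close>, the last block of the group.\<close>
  define \<pi> where "\<pi> j = (if j = 0 then 0 else
    Suc (\<rho> ((j - 1) div m) * m + ((j - 1) mod m + (m - 1 - \<alpha> ((j - 1) div m))) mod m))" for j
  have \<pi>_zero: "\<pi> 0 = 0" by (simp add: \<pi>_def)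
  have \<pi>_Suc: "\<pi> (Suc (l * m + a)) = Suc (\<rho> l * m + (a + (m - 1 - \<alpha> l)) mod m)" if "a < m" for l a
    using that by (simp add: \<pi>_def)
  have \<pi>_le: "\<pi> j \<le> k * m" if "j \<le> k * m" for j
  proof (cases "j = 0")
    case False
    then obtain l a where a: "a < m" "j = Suc (l * m + a)"
      using m group_index_cases[of m j] by blast
    then have "l < k" using that group_index_less by blast
    with a m show ?thesis
      by (simp only: \<pi>_Suc) (intro group_index_le, auto simp: \<rho>_less)
  qed (simp add: \<pi>_zero)
  have \<pi>_inj: "inj_on \<pi> {0..k * m}"
  proof (rule inj_onI)
    fix i j assume i: "i \<in> {0..k * m}" and j: "j \<in> {0..k * m}" and eq: "\<pi> i = \<pi> j"
    show "i = j"
    proof (cases "i = 0 \<or> j = 0")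
      case True
      with eq show ?thesis by (auto simp: \<pi>_def split: if_splits)
    next
      case False
      then obtain l a where a: "a < m" "i = Suc (l * m + a)"
        using m group_index_cases[of m i] by blast
      from False obtain l' b where b: "b < m" "j = Suc (l' * m + b)"
        using m group_index_cases[of m j] by blast
      have "l < k" "l' < k"
        using a b i j group_index_less by auto
      have "\<rho> l * m + (a + (m - 1 - \<alpha> l)) mod m = \<rho> l' * m + (b + (m - 1 - \<alpha> l')) mod m"
        using eq a b by (simp add: \<pi>_Suc)
      then have "\<rho> l = \<rho> l'" and mod_eq: "(a + (m - 1 - \<alpha> l)) mod m = (b + (m - 1 - \<alpha> l')) mod m"
        using m by (subst (asm) group_index_inject; simp)+
      then have "l = l'"
        using \<rho>_inj \<open>l < k\<close> \<open>l' < k\<close> by (auto dest: inj_onD)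
      with mod_eq have "[a + (m - 1 - \<alpha> l) = b + (m - 1 - \<alpha> l)] (mod m)"
        by (simp add: cong_def)
      then have "a = b"
        using a b by (simp add: cong_add_rcancel_nat cong_less_modulus_unique_nat)
      with a b \<open>l = l'\<close> show ?thesis by simp
    qed
  qed
  have \<pi>_surj: "\<pi> ` {0..k * m} = {0..k * m}"
  proof (rule endo_inj_surj[OF _ _ \<pi>_inj])
    show "\<pi> ` {0..k * m} \<subseteq> {0..k * m}"
      using \<pi>_le by (simp add: image_subset_iff)
  qed simp
  \<comment> \<open>Relabelling commutes with changing the color, both being shifts modulo
    \<open>m\<close> within a group. Applying \<open>\<pi>\<close> to the letters therefore only
    relabels the blocks.\<close>
  have \<pi>_block_index: "block_index m (\<pi> x) c = \<pi> (block_index m x c)" for x c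
  proof (cases "x = 0")
    case False
    then obtain l a where a: "a < m" "x = Suc (l * m + a)"
      using m group_index_cases[of m x] by blast
    moreover have "((a + (m - 1 - \<alpha> l)) mod m + c) mod m = ((a + c) mod m + (m - 1 - \<alpha> l)) mod m"
      by (simp add: mod_simps ac_simps)
    ultimately show ?thesis
      using m by (simp add: \<pi>_Suc block_index_Suc)
  qed (simp add: \<pi>_zero)
  define w where "w = restrict (\<pi> \<circ> v) {1..n}"
  have v_le: "v i \<le> k * m" if "i \<in> {1..n}" for i
    using v that by (auto simp: labelling_words_def)
  have "word_block m n w (\<pi> j) = word_block m n v j" if j: "j \<le> k * m" for j
  proof -
    have "block_index m (w i) c = \<pi> j \<longleftrightarrow> block_index m (v i) c = j" if "i \<in> {1..n}" for i c
      using inj_onD[OF \<pi>_inj, of "block_index m (v i) c" j] j that block_index_le[OF m v_le, of i]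
      by (auto simp: w_def \<pi>_block_index)
    moreover have "\<pi> j = 0 \<longleftrightarrow> j = 0"
      by (simp add: \<pi>_def)
    ultimately show ?thesis
      unfolding word_block_def by auto
  qed
  then have "word_block m n w ` \<pi> ` {0..k * m} = word_block m n v ` {0..k * m}"
    by (auto simp: image_image)
  moreover have "w \<in> growth_words m n k"
    unfolding growth_words_def
  proof (intro CollectI conjI allI impI)
    show "w \<in> {1..n} \<rightarrow>\<^sub>E {0..k * m}"
      using \<pi>_le v_le by (auto simp: w_def)
    fix l assume "l < k"
    then obtain g where g: "g < k" "\<rho> g = l"
      using \<rho>_surj by (metis imageE lessThan_iff)
    have "w (t g) = Suc l * m"
      using t[OF g(1)] \<alpha>[OF g(1)] g by (simp add: w_def \<pi>_Suc)
    \<comment> \<open>A nonzero earlier letter lies in a group with a smaller least base, which has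
      received a lower rank.\<close>
    moreover have "w i \<le> l * m" if i: "i \<in> {1..<t g}" for i
    proof (cases "v i = 0")
      case True
      then show ?thesis using i t[OF g(1)] by (simp add: w_def \<pi>_zero)
    next
      case False
      then obtain g' a where a: "a < m" "v i = Suc (g' * m + a)"
        using m group_index_cases[of m "v i"] by blast
      have "i \<in> {1..n}" using i t[OF g(1)] by auto
      then have "g' < k"
        using a v_le group_index_less by metis
      have "t g' < t g"
        using t_le[OF \<open>i \<in> {1..n}\<close> a] i by simp
      then have "\<rho> g' < l"
        using \<rho>_mono \<open>g' < k\<close> g by blast
      then show ?thesis
        using \<open>i \<in> {1..n}\<close> a m group_index_le[of "(a + (m - 1 - \<alpha> g')) mod m" m "\<rho> g'" l]
        by (simp add: w_def \<pi>_Suc)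
    qed
    ultimately show "\<exists>i\<in>{1..n}. w i = Suc l * m \<and> (\<forall>i'\<in>{1..<i}. w i' \<le> l * m)"
      using t[OF g(1)] by blast
  qed
  ultimately show ?thesis
    using that \<pi>_surj by simp
qed

text \<open>Every labelling can be put into standard form without changing the set of blocks.
  Together with \<open>word_block_image_inj_on\<close> this makes the growth words correspond
  bijectively to the partitions.\<close>

lemma colored_partitions_eq:
  assumes m: "m > 0"
  shows "colored_partitions m n k = (\<lambda>w. word_block m n w ` {0..k * m}) ` growth_words m n k"
proof (intro equalityI subsetI)
  fix P assume "P \<in> colored_partitions m n k"
  then obtain S where S: "colored_labelling m n k S" "P = S ` {0..k * m}"
    by (auto simp: colored_partitions_def)
  then obtain v where v: "v \<in> labelling_words m n k" "P = word_block m n v ` {0..k * m}"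
    using colored_labelling_word[OF m S(1)] by (metis (no_types, lifting) atLeastAtMost_iff image_cong)
  with ex_growth_word[OF m v(1)] show "P \<in> (\<lambda>w. word_block m n w ` {0..k * m}) ` growth_words m n k"
    by (metis (no_types, lifting) image_eqI)
next
  fix P assume "P \<in> (\<lambda>w. word_block m n w ` {0..k * m}) ` growth_words m n k"
  then show "P \<in> colored_partitions m n k"
    using colored_labelling_word_block[OF m] growth_words_subset[OF m]
    unfolding colored_partitions_def by blast
qed

subsection \<open>Inversions\<close>

text \<open>The running maximum of the letters is encoded by a witness \<open>i'\<close>, so that
  neither \<open>m\<close> nor \<open>k\<close> enters and the set depends only on the first
  \<open>n\<close> letters.\<close>

definition word_inversions :: "nat \<Rightarrow> (nat \<Rightarrow> nat) \<Rightarrow> (nat \<times> nat) set" where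
  "word_inversions n w = {(i, l). i \<in> {1..n} \<and> w i < l \<and> (\<exists>i'\<in>{1..i}. l \<le> w i')}"

text \<open>The block with index \<open>l\<close> has least base at most \<open>i\<close> iff its group has been opened by one of the
  letters up to \<open>i\<close>, that is, iff one of these letters is at least \<open>l\<close>.\<close>

lemma minb_word_block_le_iff:
  assumes m: "m > 0" and w: "w \<in> growth_words m n k"
    and "0 < l" "l \<le> k * m" "i \<le> n"
  shows "minb m (word_block m n w l) \<le> i \<longleftrightarrow> (\<exists>i'\<in>{1..i}. l \<le> w i')"
proof -
  obtain g b where b: "b < m" "l = Suc (g * m + b)"
    using m \<open>0 < l\<close> group_index_cases[of m l] by blast
  then have "g < k" using \<open>l \<le> k * m\<close> group_index_less by blast
  obtain s where s: "s \<in> {1..n}" "w s = Suc g * m" "\<And>i. i \<in> {1..<s} \<Longrightarrow> w i \<le> g * m"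
      "\<And>b. b < m \<Longrightarrow> minb m (word_block m n w (Suc (g * m + b))) = s"
    by (rule growth_word_first[OF w \<open>g < k\<close>], rule that)
  have "s \<le> i \<longleftrightarrow> (\<exists>i'\<in>{1..i}. l \<le> w i')"
  proof
    assume "s \<le> i"
    with s b show "\<exists>i'\<in>{1..i}. l \<le> w i'" by (intro bexI[of _ s]) auto
  next
    assume "\<exists>i'\<in>{1..i}. l \<le> w i'"
    then obtain i' where i': "i' \<in> {1..i}" "l \<le> w i'" by blast
    then show "s \<le> i"
      using s(3)[of i'] b by fastforce
  qed
  with s(4)[OF b(1)] b show ?thesis by simp
qed

text \<open>The only block that can contain \<open>i\<close> with color 0 is the one with index
  \<open>w i\<close>, and \<open>minb_word_block_le_iff\<close> translates the remaining
  condition.\<close>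

lemma inversions_eq:
  assumes m: "m > 0" and w: "w \<in> growth_words m n k"
    and S: "\<And>j. j \<le> k * m \<Longrightarrow> S j = word_block m n w j"
  shows "inversions m n k S = (\<lambda>(i, l). (colored m i 0, S l)) ` word_inversions n w"
proof -
  have "i \<in> {1..n} \<and> (\<exists>j<l. l \<le> k * m \<and> colored m i 0 \<in> S j \<and> minb m (S l) \<le> i) \<longleftrightarrow>
      (i, l) \<in> word_inversions n w" for i l
  proof
    assume asm: "i \<in> {1..n} \<and> (\<exists>j<l. l \<le> k * m \<and> colored m i 0 \<in> S j \<and> minb m (S l) \<le> i)"
    then obtain j where j: "j < l" "l \<le> k * m" "colored m i 0 \<in> S j" "minb m (S l) \<le> i"
      by blast
    then have "w i = j"
      using S[of j] m by (simp add: colored_in_word_block)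
    with asm j show "(i, l) \<in> word_inversions n w"
      using minb_word_block_le_iff[OF m w, of l i] S[of l] by (auto simp: word_inversions_def)
  next
    assume asm: "(i, l) \<in> word_inversions n w"
    then obtain i' where i': "i' \<in> {1..i}" "l \<le> w i'" and i: "i \<in> {1..n}" "w i < l"
      by (auto simp: word_inversions_def)
    then have le: "l \<le> k * m"
      using growth_words_le[OF w, of i'] by simp
    have "minb m (S l) \<le> i"
      using minb_word_block_le_iff[OF m w, of l i] S[OF le] le i i' by auto
    moreover have "colored m i 0 \<in> S (w i)"
      using S[of "w i"] growth_words_le[OF w i(1)] i m by (simp add: colored_in_word_block)
    ultimately show "i \<in> {1..n} \<and> (\<exists>j<l. l \<le> k * m \<and> colored m i 0 \<in> S j \<and> minb m (S l) \<le> i)"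
      using i le by blast
  qed
  note iff = this
  have "inversions m n k S = (\<lambda>(i, l). (colored m i 0, S l)) `
      {(i, l). i \<in> {1..n} \<and> (\<exists>j<l. l \<le> k * m \<and> colored m i 0 \<in> S j \<and> minb m (S l) \<le> i)}"
    unfolding inversions_def by (auto simp: image_iff)
  then show ?thesis
    by (simp only: iff case_prod_unfold) simp
qed

text \<open>The standard form picked by \<open>SOME\<close> comes from a growth word with the same
  set of blocks, and injectivity makes that word \<open>w\<close>. Distinct labels name distinct
  blocks, so passing from pairs of numbers to pairs of a vector and a block preserves the
  count.\<close>

lemma inv_number_word_block:
  assumes m: "m > 0" and w: "w \<in> growth_words m n k"
  shows "inv_number m n k (word_block m n w ` {0..k * m}) = card (word_inversions n w)"
proof -
  define P where "P = word_block m n w ` {0..k * m}"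
  define S where "S = (SOME S. standard_form m n k P S)"
  have std: "standard_form m n k P S"
    unfolding S_def using standard_form_word_block[OF m w] by (metis P_def someI)
  then obtain w' where w': "w' \<in> growth_words m n k"
    and S: "\<And>j. j \<le> k * m \<Longrightarrow> S j = word_block m n w' j"
    using standard_form_word[OF m] by blast
  have "word_block m n w' ` {0..k * m} = word_block m n w ` {0..k * m}"
    using std S by (simp add: standard_form_def P_def)
  then have "w' = w"
    by (rule inj_onD[OF word_block_image_inj_on[OF m] _ w' w])
  have "inj_on (\<lambda>(i, l). (colored m i 0, S l)) (word_inversions n w)"
  proof (rule inj_onI, clarify)
    fix i l j l' assume *: "(i, l) \<in> word_inversions n w" "(j, l') \<in> word_inversions n w"
      "colored m i 0 = colored m j 0" "S l = S l'"
    have le: "l \<le> k * m" if il: "(i, l) \<in> word_inversions n w" for i l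
    proof -
      obtain i' where "i' \<in> {1..i}" "l \<le> w i'" "i \<le> n"
        using il by (auto simp: word_inversions_def)
      then show ?thesis
        using growth_words_le[OF w, of i'] by simp
    qed
    have "word_block m n w l = word_block m n w l'"
      using *(4) S le[OF *(1)] le[OF *(2)] \<open>w' = w\<close> by simp
    moreover have "inj_on (word_block m n w) {0..k * m}"
      using word_block_inj_on[OF m] growth_words_subset[OF m] w by blast
    ultimately have "l = l'"
      using le[OF *(1)] le[OF *(2)] by (simp add: inj_on_def)
    with * m show "i = j \<and> l = l'"
      by (simp add: colored_inject)
  qed
  then have "card (inversions m n k S) = card (word_inversions n w)"
    using inversions_eq[OF m w, of S] S \<open>w' = w\<close> by (simp add: card_image)
  then show ?thesis
    by (simp add: inv_number_def S_def P_def)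
qed

section \<open>Stirling numbers as sums over words, and the effect of the last letter\<close>

lemma q_stirling_eq_sum_words:
  assumes "m > 0"
  shows "q_stirling q m n k = (\<Sum>w\<in>growth_words m n k. q ^ card (word_inversions n w))"
  unfolding q_stirling_def colored_partitions_eq[OF assms]
  by (simp add: sum.reindex[OF word_block_image_inj_on[OF assms]] inv_number_word_block[OF assms])

lemma finite_growth_words: "finite (growth_words m n k)"
  unfolding growth_words_def
  by (rule finite_subset[of _ "{1..n} \<rightarrow>\<^sub>E {0..k * m}"]) (auto intro: finite_PiE)

lemma finite_word_inversions: "finite (word_inversions n w)"
  by (rule finite_subset[of _ "{1..n} \<times> {..Max (w ` {1..n})}"])
    (force simp: word_inversions_def Max_ge_iff)+

text \<open>\<open>K\<close> is the maximum of the whole word, so the new pairs are those of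
  \<open>Suc n\<close> with the labels from above the last letter up to \<open>K\<close>.\<close>

lemma card_word_inversions_Suc:
  assumes "\<And>i. i \<in> {1..Suc n} \<Longrightarrow> w i \<le> K" "K = 0 \<or> (\<exists>i\<in>{1..Suc n}. w i = K)"
  shows "card (word_inversions (Suc n) w) = card (word_inversions n w) + (K - w (Suc n))"
proof -
  \<comment> \<open>For \<open>K = 0\<close> all letters vanish and the last one attains the
    maximum.\<close>
  have top: "\<exists>i\<in>{1..Suc n}. w i = K"
    using assms(1)[of "Suc n"] assms(2) by auto
  have "l \<le> K" if "i' \<in> {1..Suc n}" "l \<le> w i'" for l i'
    using assms(1)[of i'] that by simp
  then have *: "word_inversions (Suc n) w = word_inversions n w \<union> {Suc n} \<times> {w (Suc n)<..K}"
    using top unfolding word_inversions_def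
    by (auto simp: atLeastAtMostSuc_conv le_Suc_eq)
  have "word_inversions n w \<inter> {Suc n} \<times> {w (Suc n)<..K} = {}"
    by (auto simp: word_inversions_def)
  then show ?thesis
    unfolding * by (simp add: card_Un_disjoint finite_word_inversions card_cartesian_product)
qed

lemma word_inversions_cong:
  assumes "\<And>i. i \<in> {1..n} \<Longrightarrow> w i = w' i"
  shows "word_inversions n w = word_inversions n w'"
  using assms by (simp add: word_inversions_def cong: conj_cong bex_cong_simp)

lemma word_inversions_upd [simp]: "word_inversions n (w(Suc n := a)) = word_inversions n w"
  by (rule word_inversions_cong) auto

subsection \<open>The recurrence\<close>

lemma growth_words_0: "growth_words m 0 k = (if k = 0 then {\<lambda>_. undefined} else {})"
  by (auto simp: growth_words_def)

text \<open>For positive \<open>k\<close> the last group is opened by the letter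
  \<open>k * m\<close>. So \<open>k * m\<close> can serve as \<open>K\<close> in
  \<open>card_word_inversions_Suc\<close>.\<close>

lemma growth_words_top:
  assumes "w \<in> growth_words m n k"
  shows "k * m = 0 \<or> (\<exists>i\<in>{1..n}. w i = k * m)"
  using assms by (cases k) (auto simp: growth_words_def)

lemma growth_words_upd:
  assumes w: "w \<in> growth_words m n k" and "a \<le> k * m"
  shows "w(Suc n := a) \<in> growth_words m (Suc n) k"
  unfolding growth_words_def
proof (intro CollectI conjI allI impI)
  show "w(Suc n := a) \<in> {1..Suc n} \<rightarrow>\<^sub>E {0..k * m}"
    using assms by (auto simp: growth_words_def PiE_iff extensional_def)
  fix l assume "l < k"
  with w obtain i where "i \<in> {1..n}" "w i = Suc l * m" "\<forall>i'\<in>{1..<i}. w i' \<le> l * m"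
    unfolding growth_words_def by blast
  then show "\<exists>i\<in>{1..Suc n}. (w(Suc n := a)) i = Suc l * m \<and>
      (\<forall>i'\<in>{1..<i}. (w(Suc n := a)) i' \<le> l * m)"
    by (intro bexI[of _ i]) auto
qed

lemma growth_words_upd_new:
  assumes w: "w \<in> growth_words m n k"
  shows "w(Suc n := Suc k * m) \<in> growth_words m (Suc n) (Suc k)"
  unfolding growth_words_def
proof (intro CollectI conjI allI impI)
  show "w(Suc n := Suc k * m) \<in> {1..Suc n} \<rightarrow>\<^sub>E {0..Suc k * m}"
    using growth_words_upd[OF w, of 0] w
    by (auto simp: growth_words_def PiE_iff extensional_def intro: trans_le_add2)
  fix l assume "l < Suc k"
  then consider "l < k" | "l = k" by linarith
  then show "\<exists>i\<in>{1..Suc n}. (w(Suc n := Suc k * m)) i = Suc l * m \<and>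
      (\<forall>i'\<in>{1..<i}. (w(Suc n := Suc k * m)) i' \<le> l * m)"
  proof cases
    case 1
    with w obtain i where "i \<in> {1..n}" "w i = Suc l * m" "\<forall>i'\<in>{1..<i}. w i' \<le> l * m"
      unfolding growth_words_def by blast
    then show ?thesis
      by (intro bexI[of _ i]) auto
  next
    case 2
    then show ?thesis
      using growth_words_le[OF w] by (intro bexI[of _ "Suc n"]) auto
  qed
qed

text \<open>If removing the last letter destroys the growth condition for some group
  \<open>l\<close>, the last letter was the one opening that group, so all earlier letters are at
  most \<open>l * m\<close>. Then no later group can be opened, and the shortened word is a growth
  word with one group fewer.\<close>

lemma growth_words_Suc_cases:
  assumes m: "m > 0" and u: "u \<in> growth_words m (Suc n) k"
  obtains (old) w a where "w \<in> growth_words m n k" "a \<le> k * m" "u = w(Suc n := a)"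
  | (new) w k' where "k = Suc k'" "w \<in> growth_words m n k'" "u = w(Suc n := k * m)"
proof -
  \<comment> \<open>The value \<open>undefined\<close> at \<open>Suc n\<close> keeps the shortened
    word extensional on \<open>{1..n}\<close>.\<close>
  define w where "w = u(Suc n := undefined)"
  have u_eq: "u = w(Suc n := u (Suc n))"
    by (simp add: w_def)
  have w_eq: "w i = u i" if "i \<in> {1..n}" for i
    using that by (simp add: w_def)
  have u_le: "u i \<le> k * m" if "i \<in> {1..Suc n}" for i
    using growth_words_le[OF u that] .
  have w_ext: "w \<in> extensional {1..n}"
    using u by (auto simp: growth_words_def PiE_iff extensional_def w_def)
  have witness: "\<exists>i\<in>{1..Suc n}. u i = Suc l * m \<and> (\<forall>i'\<in>{1..<i}. u i' \<le> l * m)" if "l < k" for l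
    using u that unfolding growth_words_def by blast
  have w_witness: "\<exists>i\<in>{1..n}. w i = Suc l * m \<and> (\<forall>i'\<in>{1..<i}. w i' \<le> l * m)"
    if i: "i \<in> {1..n}" "u i = Suc l * m" "\<forall>i'\<in>{1..<i}. u i' \<le> l * m" for i l
    using i by (intro bexI[of _ i]) (auto simp: w_eq)
  show ?thesis
  proof (cases "w \<in> growth_words m n k")
    case True
    with u_eq u_le show ?thesis by (intro old[of w "u (Suc n)"]) auto
  next
    case False
    have "w \<in> {1..n} \<rightarrow>\<^sub>E {0..k * m}"
      using w_ext u_le w_eq by (auto simp: PiE_iff)
    with False obtain l where l: "l < k"
        "\<not> (\<exists>i\<in>{1..n}. w i = Suc l * m \<and> (\<forall>i'\<in>{1..<i}. w i' \<le> l * m))"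
      unfolding growth_words_def by blast
    obtain i where i: "i \<in> {1..Suc n}" "u i = Suc l * m" "\<forall>i'\<in>{1..<i}. u i' \<le> l * m"
      using witness[OF l(1)] by blast
    then have "i = Suc n"
      using w_witness[of i l] l(2) by (metis atLeastAtMost_iff le_Suc_eq)
    with i have last: "u (Suc n) = Suc l * m" and before: "\<And>i. i \<in> {1..n} \<Longrightarrow> u i \<le> l * m"
      by auto
    \<comment> \<open>One more group would need the letter \<open>Suc (Suc l) * m\<close>, which
      exceeds the last letter and all earlier ones.\<close>
    have "k = Suc l"
    proof (rule ccontr)
      assume "k \<noteq> Suc l"
      with l(1) have "Suc l < k" by simp
      then obtain i' where i': "i' \<in> {1..Suc n}" "u i' = Suc (Suc l) * m"
        using witness by blast
      then show False
        using last before[of i'] m by (cases "i' = Suc n") auto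
    qed
    moreover have "w \<in> growth_words m n l"
      unfolding growth_words_def
    proof (intro CollectI conjI allI impI)
      show "w \<in> {1..n} \<rightarrow>\<^sub>E {0..l * m}"
        using w_ext before w_eq by (auto simp: PiE_iff)
      fix g assume g: "g < l"
      then obtain i' where i': "i' \<in> {1..Suc n}" "u i' = Suc g * m" "\<forall>i''\<in>{1..<i'}. u i'' \<le> g * m"
        using witness[of g] \<open>k = Suc l\<close> by auto
      moreover have "i' \<noteq> Suc n"
        using last i' g m by auto
      ultimately show "\<exists>i\<in>{1..n}. w i = Suc g * m \<and> (\<forall>i'\<in>{1..<i}. w i' \<le> g * m)"
        by (intro w_witness[of i' g]) auto
    qed
    ultimately show ?thesis
      using u_eq last by (intro new[of l w]) auto
  qed
qed

text \<open>Both words take the value \<open>undefined\<close> at \<open>Suc n\<close>, so undoing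
  the update recovers them.\<close>

lemma growth_words_upd_inject:
  assumes "w \<in> growth_words m n k" "w' \<in> growth_words m n k'" "w(Suc n := a) = w'(Suc n := a')"
  shows "w = w' \<and> a = a'"
proof -
  have "w (Suc n) = undefined" "w' (Suc n) = undefined"
    using assms(1,2) by (auto simp: growth_words_def PiE_iff extensional_def)
  with assms(3) show ?thesis
    by (metis fun_upd_idem_iff fun_upd_same fun_upd_upd)
qed

lemma card_word_inversions_upd:
  assumes "w \<in> growth_words m n k" "a \<le> k * m"
  shows "card (word_inversions (Suc n) (w(Suc n := a))) = card (word_inversions n w) + (k * m - a)"
  using card_word_inversions_Suc[of n "w(Suc n := a)" "k * m"]
    growth_words_le[OF growth_words_upd[OF assms]] growth_words_top[OF growth_words_upd[OF assms]]
  by simp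

text \<open>A letter that opens a new group is itself the new maximum, so no label lies above
  it.\<close>

lemma card_word_inversions_upd_new:
  assumes "w \<in> growth_words m n k"
  shows "card (word_inversions (Suc n) (w(Suc n := Suc k * m))) = card (word_inversions n w)"
  using card_word_inversions_Suc[of n "w(Suc n := Suc k * m)" "Suc k * m"]
    growth_words_le[OF growth_words_upd_new[OF assms]]
    growth_words_top[OF growth_words_upd_new[OF assms]]
  by simp

lemma q_stirling_0:
  assumes "m > 0"
  shows "q_stirling q m 0 k = (if k = 0 then 1 else 0)"
  using assms by (simp add: q_stirling_eq_sum_words growth_words_0 word_inversions_def)

lemma q_stirling_Suc:
  assumes m: "m > 0"
  shows "q_stirling q m (Suc n) k =
    q_int q (Suc (k * m)) * q_stirling q m n k + (if k = 0 then 0 else q_stirling q m n (k - 1))"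
proof -
  define old where "old = (\<lambda>(w, a). w(Suc n := a)) ` (growth_words m n k \<times> {..k * m})"
  define new where "new = (if k = 0 then {} else (\<lambda>w. w(Suc n := k * m)) ` growth_words m n (k - 1))"
  have "growth_words m (Suc n) k = old \<union> new"
  proof (intro equalityI subsetI)
    fix u assume "u \<in> growth_words m (Suc n) k"
    with m show "u \<in> old \<union> new"
      by (cases rule: growth_words_Suc_cases) (auto simp: old_def new_def)
  next
    fix u assume "u \<in> old \<union> new"
    then show "u \<in> growth_words m (Suc n) k"
      using growth_words_upd[of _ m n k] growth_words_upd_new[of _ m n]
      by (cases k) (auto simp: old_def new_def simp del: mult_Suc)
  qed
  \<comment> \<open>For positive \<open>k\<close> the letter \<open>k * m\<close> already occurs
    among the first \<open>n\<close> letters of an old word, whereas in a new word these are at most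
    \<open>(k - 1) * m\<close>.\<close>
  moreover have "old \<inter> new = {}"
  proof (rule ccontr)
    assume "old \<inter> new \<noteq> {}"
    then obtain w a w' where w: "w \<in> growth_words m n k" "w' \<in> growth_words m n (k - 1)" "k > 0"
        and eq: "w(Suc n := a) = w'(Suc n := k * m)"
      by (auto simp: old_def new_def split: if_splits)
    then have "w = w'"
      using growth_words_upd_inject[OF w(1,2) eq] by simp
    obtain i where "i \<in> {1..n}" "w i = k * m"
      using growth_words_top[OF w(1)] w(3) m by auto
    then have "k * m \<le> (k - 1) * m"
      using growth_words_le[OF w(2)] \<open>w = w'\<close> by metis
    with w(3) m show False by simp
  qed
  ultimately have "q_stirling q m (Suc n) k =
      (\<Sum>u\<in>old. q ^ card (word_inversions (Suc n) u)) + (\<Sum>u\<in>new. q ^ card (word_inversions (Suc n) u))"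
    using finite_growth_words[of m "Suc n" k] by (simp add: q_stirling_eq_sum_words[OF m] sum.union_disjoint)
  also have "(\<Sum>u\<in>new. q ^ card (word_inversions (Suc n) u)) =
      (if k = 0 then 0 else q_stirling q m n (k - 1))"
  proof (cases k)
    case (Suc k')
    have "inj_on (\<lambda>w. w(Suc n := k * m)) (growth_words m n k')"
      by (auto intro!: inj_onI dest: growth_words_upd_inject)
    then show ?thesis
      using card_word_inversions_upd_new[of _ m n k'] Suc
      by (simp add: new_def sum.reindex q_stirling_eq_sum_words[OF m] del: mult_Suc)
  qed (simp add: new_def)
  also have "(\<Sum>u\<in>old. q ^ card (word_inversions (Suc n) u)) = q_int q (Suc (k * m)) * q_stirling q m n k"
  proof -
    have "inj_on (\<lambda>(w, a). w(Suc n := a)) (growth_words m n k \<times> {..k * m})"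
      by (auto intro!: inj_onI dest: growth_words_upd_inject)
    then have "(\<Sum>u\<in>old. q ^ card (word_inversions (Suc n) u)) =
        (\<Sum>(w, a)\<in>growth_words m n k \<times> {..k * m}. q ^ card (word_inversions (Suc n) (w(Suc n := a))))"
      by (simp add: old_def sum.reindex case_prod_unfold)
    also have "\<dots> = (\<Sum>w\<in>growth_words m n k. \<Sum>a\<le>k * m. q ^ card (word_inversions n w) * q ^ (k * m - a))"
      unfolding sum.cartesian_product[symmetric]
      by (intro sum.cong refl) (simp only: card_word_inversions_upd power_add atMost_iff)
    also have "\<dots> = (\<Sum>w\<in>growth_words m n k. q ^ card (word_inversions n w)) * (\<Sum>a\<le>k * m. q ^ (k * m - a))"
      by (rule sum_product[symmetric])
    \<comment> \<open>Substituting \<open>k * m - a\<close> for \<open>a\<close> turns the inversion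
      counts into the exponents from 0 to \<open>k * m\<close>.\<close>
    also have "(\<Sum>a\<le>k * m. q ^ (k * m - a)) = q_int q (Suc (k * m))"
      unfolding q_int_def lessThan_Suc_atMost
      by (rule sum.reindex_bij_witness[of _ "\<lambda>a. k * m - a" "\<lambda>a. k * m - a"]) auto
    finally show ?thesis
      by (simp add: q_stirling_eq_sum_words[OF m] mult.commute)
  qed
  finally show ?thesis .
qed

section \<open>Vanishing terms, the factorial factor and the alternating sum\<close>

lemma q_stirling_eq_0:
  assumes "m > 0" "n < k"
  shows "q_stirling q m n k = 0"
  using assms(2) by (induction n arbitrary: k) (auto simp: q_stirling_0 q_stirling_Suc assms(1))

text \<open>Raising the argument by \<open>m\<close> keeps the residue class and admits one further
  factor, at the new argument itself, which equals \<open>k * m + 2\<close> and is positive even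
  when the old argument is not.\<close>

lemma q_mfact_step:
  assumes m: "m > 0"
  shows "q_mfact q m ((int (Suc k) - 1) * int m + 2) =
    q_int q (Suc (Suc (k * m))) * q_mfact q m ((int k - 1) * int m + 2)"
proof -
  define l where "l = (int k - 1) * int m + 2"
  have l': "(int (Suc k) - 1) * int m + 2 = l + int m" and l'': "l + int m = int (Suc (Suc (k * m)))"
    by (simp_all add: l_def algebra_simps)
  have "{j. 0 < j \<and> int j \<le> l + int m \<and> [int j = l + int m] (mod int m)} =
      insert (Suc (Suc (k * m))) {j. 0 < j \<and> int j \<le> l \<and> [int j = l] (mod int m)}" (is "?A = insert ?x ?B")
  proof (intro equalityI subsetI)
    fix j assume j: "j \<in> ?A"
    show "j \<in> insert ?x ?B"
    proof (cases "int j \<le> l")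
      case False
      have "[int j = l] (mod int m)"
        using j by (simp add: cong_def)
      \<comment> \<open>A further index lies less than \<open>m\<close> below the new bound and is
        congruent to it, so it is the bound.\<close>
      then have "int m dvd l + int m - int j"
        by (metis cong_add_rcancel_0 cong_iff_dvd_diff cong_sym cong_trans dvd_add_triv_right_iff add_diff_eq diff_add_eq)
      moreover have "0 \<le> l + int m - int j" "l + int m - int j < int m"
        using j False by auto
      ultimately have "l + int m - int j = 0"
        by (meson zdvd_not_zless not_less le_less)
      then show ?thesis
        using l'' by (metis add_diff_cancel_right' diff_eq_diff_eq eq_iff_diff_eq_0 insertI1 of_nat_eq_iff)
    qed (use j in \<open>auto simp: cong_def\<close>)
  next
    fix j assume "j \<in> insert ?x ?B"
    show "j \<in> ?A"
    proof (cases "j = ?x")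
      case True
      then have "int j = l + int m" "0 < j"
        using l'' by simp_all
      then show ?thesis by simp
    next
      case False
      with \<open>j \<in> insert ?x ?B\<close> show ?thesis by (auto simp: cong_def)
    qed
  qed
  moreover have "finite {j. 0 < j \<and> int j \<le> l \<and> [int j = l] (mod int m)}"
    by (rule finite_subset[of _ "{..nat l}"]) auto
  moreover have "\<not> int ?x \<le> l"
    using l'' m by linarith
  ultimately show ?thesis
    unfolding l' q_mfact_def l_def[symmetric] by simp
qed

text \<open>The argument is \<open>2 - m\<close>, which is positive only for \<open>m = 1\<close>;
  the single factor is then \<open>q_int q 1 = 1\<close>.\<close>

lemma q_mfact_start:
  assumes "m > 0"
  shows "q_mfact q m ((int 0 - 1) * int m + 2) = 1"
proof -
  have "q_int q j = 1" if "0 < j" "int j \<le> 2 - int m" for j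
  proof -
    have "j = 1" using that assms by linarith
    then show ?thesis by (simp add: q_int_def)
  qed
  then show ?thesis
    unfolding q_mfact_def by (intro prod.neutral) auto
qed

lemma q_stirling_ord_alternating_sum:
  fixes q :: "'a::comm_ring_1"
  assumes m: "m > 0"
  shows "(\<Sum>k\<le>n. (- q) ^ (n - k) * q_stirling_ord q m n k) = 1"
proof (induction n)
  case 0
  show ?case
    using q_mfact_start[OF m, of q] m by (simp add: q_stirling_ord_def q_stirling_0)
next
  case (Suc n)
  define F where "F k = q_mfact q m ((int k - 1) * int m + 2)" for k
  define G where "G k = q_stirling q m n k" for k
  have F_Suc: "F (Suc k) = q_int q (Suc (Suc (k * m))) * F k" for k
    using q_mfact_step[OF m, of q k] by (simp add: F_def)
  \<comment> \<open>Splitting off the exponent 0 from \<open>q_int q (Suc j)\<close> leaves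
    \<open>q\<close> times \<open>q_int q j\<close>. With \<open>j = k * m + 1\<close> this merges
    the two sums below.\<close>
  have q_int_step: "q_int q (Suc j) - q * q_int q j = 1" for j
    by (simp add: q_int_def sum.lessThan_Suc_shift sum_distrib_left del: sum.lessThan_Suc)
  have "(- q) ^ (Suc n - k) * q_stirling_ord q m (Suc n) k =
      (- q) ^ (Suc n - k) * F k * (q_int q (Suc (k * m)) * G k) +
      (- q) ^ (Suc n - k) * F k * (if k = 0 then 0 else G (k - 1))" for k
    unfolding q_stirling_ord_def q_stirling_Suc[OF m] F_def G_def by (simp only: distrib_left mult.assoc)
  then have "(\<Sum>k\<le>Suc n. (- q) ^ (Suc n - k) * q_stirling_ord q m (Suc n) k) =
      (\<Sum>k\<le>Suc n. (- q) ^ (Suc n - k) * F k * (q_int q (Suc (k * m)) * G k)) +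
      (\<Sum>k\<le>Suc n. (- q) ^ (Suc n - k) * F k * (if k = 0 then 0 else G (k - 1)))"
    by (simp only: sum.distrib)
  \<comment> \<open>The term for \<open>Suc n\<close> vanishes because \<open>G (Suc n) = 0\<close>,
    and one factor \<open>- q\<close> is taken out of the power in the others.\<close>
  also have "(\<Sum>k\<le>Suc n. (- q) ^ (Suc n - k) * F k * (q_int q (Suc (k * m)) * G k)) =
      (\<Sum>k\<le>n. (- q) ^ (n - k) * F k * G k * (- q * q_int q (Suc (k * m))))"
    by (simp add: G_def q_stirling_eq_0[OF m] Suc_diff_le mult_ac cong: sum.cong_simp)
  \<comment> \<open>The term for 0 is zero; shifting the index turns \<open>F (Suc k)\<close> into
    \<open>F k\<close> times the next q-integer.\<close>
  also have "(\<Sum>k\<le>Suc n. (- q) ^ (Suc n - k) * F k * (if k = 0 then 0 else G (k - 1))) =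
      (\<Sum>k\<le>n. (- q) ^ (n - k) * F k * G k * q_int q (Suc (Suc (k * m))))"
    by (subst sum.atMost_Suc_shift) (simp add: F_Suc mult_ac)
  finally have "(\<Sum>k\<le>Suc n. (- q) ^ (Suc n - k) * q_stirling_ord q m (Suc n) k) =
      (\<Sum>k\<le>n. (- q) ^ (n - k) * F k * G k * (q_int q (Suc (Suc (k * m))) - q * q_int q (Suc (k * m))))"
    by (simp add: algebra_simps flip: sum.distrib)
  also have "\<dots> = (\<Sum>k\<le>n. (- q) ^ (n - k) * q_stirling_ord q m n k)"
    unfolding q_int_step by (simp add: F_def G_def q_stirling_ord_def mult.assoc)
  finally show ?case
    using Suc.IH by simp
qed

theorem theorem4p2:
  fixes q :: "'a::field" and m n :: nat
  assumes "m \<ge> 1"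
  shows "Sum_any (\<lambda>k::nat. (- q) powi (int n - int k) * q_stirling_ord q m n k) = 1"
proof -
  have m: "m > 0" using assms by simp
  \<comment> \<open>Terms with \<open>k > n\<close> vanish through the Stirling number, whatever the
    negative power of \<open>- q\<close> is. On the remaining range the exponents are nonnegative,
    so integer powers are ordinary ones.\<close>
  have "Sum_any (\<lambda>k::nat. (- q) powi (int n - int k) * q_stirling_ord q m n k) =
      (\<Sum>k\<le>n. (- q) powi (int n - int k) * q_stirling_ord q m n k)"
  proof (rule Sum_any.expand_superset)
    show "{k. (- q) powi (int n - int k) * q_stirling_ord q m n k \<noteq> 0} \<subseteq> {..n}"
      using q_stirling_eq_0[OF m, of n] by (force simp: q_stirling_ord_def not_less[symmetric])
  qed simp
  also have "\<dots> = (\<Sum>k\<le>n. (- q) ^ (n - k) * q_stirling_ord q m n k)"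
    by (intro sum.cong) (auto simp: power_int_of_nat simp flip: of_nat_diff)
  finally show ?thesis
    using q_stirling_ord_alternating_sum[OF m] by simp
qed

end
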